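(* Let $K$ be a field, $S=K[x_1,\ldots,x_n]$, and let $0\subset I\subsetneq J\subset S$ be two monomial ideals. Then $$\operatorname{slength}(J/I)\geq \operatorname{slength}(\sqrt{J}/\sqrt{I}).$$
   Context: Let $M$ be a finitely generated $\mathbb Z^n$-graded $S$-module, $S=K[x_1,\ldots,x_n]$. A Stanley decomposition of $M$ is a finite direct sum of $K$-vector spaces $\mathcal D: M=\bigoplus_{i=1}^r m_iK[Z_i]$, where each $m_i\in M$ is homogeneous, $Z_i\subset\{x_1,\ldots,x_n\}$, and $m_iK[Z_i]$ is a free $K[Z_i]$-module. Its length is $\operatorname{slength}(\mathcal D)=r$, and the Stanley length of $M$ is $\operatorname{slength}(M)=\min\{\operatorname{slength}(\mathcal D):\mathcal D\text{ is a Stanley decomposition of }M\}$. The zero module has the empty Stanley decomposition, so $\operatorname{slength}(0)=0$. $\sqrt{I}$ denotes the radical of $I$. *)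

theory Defs
  imports "HOL-Algebra.Module" "HOL-Algebra.QuotRing" "HOL-Library.Poly_Mapping" "HOL-Library.Extended_Nat"
begin

section \<open>The polynomial ring and its monomial ideals\<close>

text \<open>
  \<open>('n, 'k) mpoly\<close> is \<open>S = K[x\<^sub>1, \<dots>, x\<^sub>n]\<close>: the finite type \<open>'n\<close> indexes the variables and
  \<open>Poly_Mapping.single t c\<close> is the term \<open>c * x^t\<close> with exponent vector \<open>t\<close>. Exponents in the
  grading group \<open>\<int>\<^sup>n\<close> are functions \<open>'n \<Rightarrow> int\<close>.
\<close>

type_synonym ('n, 'k) mpoly = "('n \<Rightarrow>\<^sub>0 nat) \<Rightarrow>\<^sub>0 'k"

definition poly_ring :: "('n::finite, 'k::field) mpoly ring" where
  "poly_ring = \<lparr>carrier = UNIV, monoid.mult = (*), one = 1, ring.zero = 0, add = (+)\<rparr>"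

definition monomial_ideal :: "('n::finite, 'k::field) mpoly set \<Rightarrow> bool" where
  "monomial_ideal I \<longleftrightarrow> (\<exists>A. I = genideal poly_ring ((\<lambda>t. Poly_Mapping.single t 1) ` A))"

definition ideal_radical :: "('n::finite, 'k::field) mpoly set \<Rightarrow> ('n, 'k) mpoly set" where
  "ideal_radical I = {f. \<exists>k>0. f ^ k \<in> I}"

definition homogeneous_polys :: "('n::finite \<Rightarrow> int) \<Rightarrow> ('n, 'k::field) mpoly set" where
  "homogeneous_polys g = {f. \<forall>t \<in> Poly_Mapping.keys f. \<forall>i. int (Poly_Mapping.lookup t i) = g i}"

definition polys_in :: "'n::finite set \<Rightarrow> ('n, 'k::field) mpoly set" where
  "polys_in Z = {f. \<forall>t \<in> Poly_Mapping.keys f. Poly_Mapping.keys t \<subseteq> Z}"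


section \<open>Multigraded modules and Stanley decompositions\<close>

record ('n, 'a, 'b) graded_module = "('a, 'b) module" +
  component :: "('n \<Rightarrow> int) \<Rightarrow> 'b set"

locale multigraded_module = Module.module poly_ring M
  for M :: "('n::finite, ('n, 'k::field) mpoly, 'b) graded_module" +
  assumes component_subgroup: "subgroup (component M g) (add_monoid M)"
    and component_decomposition:
      "x \<in> carrier M \<Longrightarrow>
        \<exists>!u. (\<forall>g. u g \<in> component M g) \<and> finite {g. u g \<noteq> \<zero>\<^bsub>M\<^esub>} \<and>
             x = finsum M u {g. u g \<noteq> \<zero>\<^bsub>M\<^esub>}"
    and component_smult:
      "p \<in> homogeneous_polys g \<Longrightarrow> x \<in> component M h \<Longrightarrow>
        p \<odot>\<^bsub>M\<^esub> x \<in> component M (\<lambda>i. g i + h i)"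

definition homogeneous_elem ::
    "('n::finite, ('n, 'k::field) mpoly, 'b) graded_module \<Rightarrow> 'b \<Rightarrow> bool" where
  "homogeneous_elem M m \<longleftrightarrow> (\<exists>g. m \<in> component M g)"

definition stanley_space ::
    "('n::finite, ('n, 'k::field) mpoly, 'b) graded_module \<Rightarrow> 'b \<Rightarrow> 'n set \<Rightarrow> 'b set" where
  "stanley_space M m Z = (\<lambda>p. p \<odot>\<^bsub>M\<^esub> m) ` polys_in Z"

text \<open>
  Freeness of \<open>m K[Z]\<close> means that \<open>m\<close> is a basis of it over \<open>K[Z]\<close>; in particular \<open>m \<noteq> 0\<close>.
  The internal direct sum of \<open>K\<close>-vector spaces is stated as unique representability of every
  element of \<open>M\<close>.
\<close>

definition stanley_decomposition ::
    "('n::finite, ('n, 'k::field) mpoly, 'b) graded_module \<Rightarrow> ('b \<times> 'n set) list \<Rightarrow> bool" where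
  "stanley_decomposition M D \<longleftrightarrow>
     (\<forall>(m, Z) \<in> set D.
        m \<in> carrier M \<and> homogeneous_elem M m \<and>
        (\<forall>p \<in> polys_in Z. p \<odot>\<^bsub>M\<^esub> m = \<zero>\<^bsub>M\<^esub> \<longrightarrow> p = 0)) \<and>
     (\<forall>x \<in> carrier M.
        \<exists>!u. u \<in> (\<Pi>\<^sub>E i \<in> {..<length D}. stanley_space M (fst (D ! i)) (snd (D ! i))) \<and>
             x = finsum M u {..<length D})"

text \<open>
  The value is in \<^typ>\<open>enat\<close> so that a module without any Stanley decomposition would get length
  \<open>\<infinity>\<close>; otherwise the infimum is the minimum of the lengths.
\<close>

definition slength :: "('n::finite, ('n, 'k::field) mpoly, 'b) graded_module \<Rightarrow> enat" where
  "slength M = (INF D \<in> {D. stanley_decomposition M D}. enat (length D))"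


section \<open>The quotient of two monomial ideals\<close>

text \<open>
  The elements of \<open>J/I\<close> are the cosets \<open>I + f\<close> with \<open>f \<in> J\<close>. The fields \<open>mult\<close> and \<open>one\<close>, which
  every module record inherits from rings, play no role and are those of \<open>S/I\<close>.
\<close>

definition quotient_module ::
    "('n::finite, 'k::field) mpoly set \<Rightarrow> ('n, 'k) mpoly set \<Rightarrow>
      ('n, ('n, 'k) mpoly, ('n, 'k) mpoly set) graded_module" where
  "quotient_module J I =
     \<lparr>carrier = (\<lambda>f. I +>\<^bsub>poly_ring\<^esub> f) ` J,
      monoid.mult = rcoset_mult poly_ring I,
      one = I +>\<^bsub>poly_ring\<^esub> \<one>\<^bsub>poly_ring\<^esub>,
      ring.zero = I,
      add = set_add poly_ring,
      smult = (\<lambda>p X. \<Union>f\<in>X. I +>\<^bsub>poly_ring\<^esub> (p * f)),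
      component = (\<lambda>g. (\<lambda>f. I +>\<^bsub>poly_ring\<^esub> f) ` (J \<inter> homogeneous_polys g))\<rparr>"


text \<open>\<open>J/I\<close> is indeed a \<open>\<int>\<^sup>n\<close>-graded \<open>S\<close>-module.\<close>

lemma poly_ring_simps [simp]:
  "carrier poly_ring = UNIV" "a \<otimes>\<^bsub>poly_ring\<^esub> b = a * b" "\<one>\<^bsub>poly_ring\<^esub> = 1"
  "\<zero>\<^bsub>poly_ring\<^esub> = 0" "a \<oplus>\<^bsub>poly_ring\<^esub> b = a + b"
  by (simp_all add: poly_ring_def)

lemma cring_poly_ring: "cring (poly_ring :: ('n::finite, 'k::field) mpoly ring)"
proof (rule cringI)
  show "abelian_group (poly_ring :: ('n, 'k) mpoly ring)"
    by (rule abelian_groupI) (auto simp: algebra_simps intro: exI[of _ "- x" for x])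
  show "comm_monoid (poly_ring :: ('n, 'k) mpoly ring)"
    by (rule comm_monoidI) (auto simp: algebra_simps)
qed (auto simp: algebra_simps)

interpretation PR: cring "poly_ring :: ('n::finite, 'k::field) mpoly ring"
  by (rule cring_poly_ring)

lemma ideal_poly_ringI:
  fixes I :: "('n::finite, 'k::field) mpoly set"
  assumes "0 \<in> I" "\<And>a b. a \<in> I \<Longrightarrow> b \<in> I \<Longrightarrow> a + b \<in> I" "\<And>a p. a \<in> I \<Longrightarrow> p * a \<in> I"
  shows "ideal I poly_ring"
proof (rule idealI[OF PR.ring_axioms])
  have m: "- a \<in> I" if "a \<in> I" for a using assms(3)[OF that, of "-1"] by simp
  have "\<ominus>\<^bsub>poly_ring\<^esub> a = - a" for a :: "('n, 'k) mpoly"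
    by (rule PR.minus_equality) auto
  then show "subgroup I (add_monoid poly_ring)"
    using m by (intro PR.add.subgroupI) (use assms in \<open>auto simp flip: a_inv_def\<close>)
qed (use assms(3) in \<open>auto simp: mult.commute\<close>)

lemma ideal_poly_ringD:
  fixes I :: "('n::finite, 'k::field) mpoly set"
  assumes "ideal I poly_ring"
  shows "0 \<in> I" "a \<in> I \<Longrightarrow> b \<in> I \<Longrightarrow> a + b \<in> I" "a \<in> I \<Longrightarrow> p * a \<in> I"
    "a \<in> I \<Longrightarrow> - a \<in> I" "a \<in> I \<Longrightarrow> b \<in> I \<Longrightarrow> a - b \<in> I"
proof -
  interpret ideal I "poly_ring :: ('n, 'k) mpoly ring" by fact
  show z: "0 \<in> I" using additive_subgroup.zero_closed[OF is_additive_subgroup] by simp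
  show p: "a + b \<in> I" if "a \<in> I" "b \<in> I" for a b
    using additive_subgroup.a_closed[OF is_additive_subgroup that] by simp
  show l: "p * a \<in> I" if "a \<in> I" for a p using I_l_closed[OF that, of p] by simp
  show m: "- a \<in> I" if "a \<in> I" for a using l[OF that, of "-1"] by simp
  show "a \<in> I \<Longrightarrow> b \<in> I \<Longrightarrow> a - b \<in> I" using p[of a "- b"] m[of b] by simp
qed

lemma ideal_poly_ring_sum:
  assumes "ideal I poly_ring" "\<And>x. x \<in> A \<Longrightarrow> f x \<in> I"
  shows "sum f A \<in> I"
  using assms(2)
  by (induction A rule: infinite_finite_induct) (auto intro: ideal_poly_ringD[OF assms(1)])

lemma monomial_ideal_imp_ideal: "monomial_ideal I \<Longrightarrow> ideal I poly_ring"
  by (auto simp: monomial_ideal_def intro: PR.genideal_ideal)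

lemma poly_mapping_eq_sum_terms:
  "f = (\<Sum>t \<in> Poly_Mapping.keys f. Poly_Mapping.single t (Poly_Mapping.lookup f t))"
  by (rule poly_mapping_eqI)
    (auto simp: lookup_sum lookup_single when_def sum.delta' in_keys_iff)

lemma monomial_ideal_iff:
  fixes I :: "('n::finite, 'k::field) mpoly set"
  assumes "monomial_ideal I"
  shows "f \<in> I \<longleftrightarrow> (\<forall>t \<in> Poly_Mapping.keys f. Poly_Mapping.single t 1 \<in> I)"
proof
  define T where "T = {f :: ('n, 'k) mpoly. \<forall>t \<in> Poly_Mapping.keys f. Poly_Mapping.single t 1 \<in> I}"
  note I = monomial_ideal_imp_ideal[OF assms]
  obtain A where A: "I = genideal poly_ring ((\<lambda>t. Poly_Mapping.single t 1) ` A)"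
    using assms by (auto simp: monomial_ideal_def)
  have "ideal T poly_ring"
  proof (rule ideal_poly_ringI)
    show "0 \<in> T" by (simp add: T_def)
    show "a + b \<in> T" if "a \<in> T" "b \<in> T" for a b
      using that Poly_Mapping.keys_add[of a b] by (auto simp: T_def)
    show "p * a \<in> T" if "a \<in> T" for a p
    proof -
      have "Poly_Mapping.single t 1 \<in> I" if t: "t \<in> Poly_Mapping.keys (p * a)" for t
      proof -
        obtain r s where "t = r + s" and s: "s \<in> Poly_Mapping.keys a"
          using keys_mult[of p a] t by blast
        then have "(Poly_Mapping.single t 1 :: ('n, 'k) mpoly)
            = Poly_Mapping.single r 1 * Poly_Mapping.single s 1"
          by (simp add: mult_single)
        then show ?thesis
          using \<open>a \<in> T\<close> s ideal_poly_ringD(3)[OF I] by (auto simp: T_def)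
      qed
      then show ?thesis by (simp add: T_def)
    qed
  qed
  moreover have "(\<lambda>t. Poly_Mapping.single t 1) ` A \<subseteq> T"
    using PR.genideal_self[of "(\<lambda>t. Poly_Mapping.single t 1) ` A"] by (auto simp: T_def A)
  ultimately have "I \<subseteq> T"
    unfolding A by (rule PR.genideal_minimal)
  then show "f \<in> I \<Longrightarrow> \<forall>t \<in> Poly_Mapping.keys f. Poly_Mapping.single t 1 \<in> I"
    by (auto simp: T_def)
  assume *: "\<forall>t \<in> Poly_Mapping.keys f. Poly_Mapping.single t 1 \<in> I"
  have "Poly_Mapping.single t (Poly_Mapping.lookup f t) \<in> I" if "t \<in> Poly_Mapping.keys f" for t
  proof -
    have "Poly_Mapping.single t (Poly_Mapping.lookup f t)
        = Poly_Mapping.single 0 (Poly_Mapping.lookup f t) * Poly_Mapping.single t 1"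
      by (simp add: mult_single)
    then show ?thesis using that * ideal_poly_ringD(3)[OF I] by metis
  qed
  then have "(\<Sum>t \<in> Poly_Mapping.keys f. Poly_Mapping.single t (Poly_Mapping.lookup f t)) \<in> I"
    by (intro ideal_poly_ring_sum[OF I])
  then show "f \<in> I" by (simp flip: poly_mapping_eq_sum_terms)
qed

lemma coset_eq_iff:
  fixes I :: "('n::finite, 'k::field) mpoly set"
  assumes "ideal I poly_ring"
  shows "I +>\<^bsub>poly_ring\<^esub> a = I +>\<^bsub>poly_ring\<^esub> b \<longleftrightarrow> a - b \<in> I"
proof
  note I = ideal_poly_ringD[OF assms]
  have coset: "I +>\<^bsub>poly_ring\<^esub> c = {h + c |h. h \<in> I}" for c
    by (auto simp: a_r_coset_def')
  show "a - b \<in> I" if "I +>\<^bsub>poly_ring\<^esub> a = I +>\<^bsub>poly_ring\<^esub> b"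
  proof -
    have "0 + a \<in> I +>\<^bsub>poly_ring\<^esub> a" unfolding coset using I(1) by blast
    then have "0 + a \<in> {h + b |h. h \<in> I}" unfolding that unfolding coset .
    then obtain h where "0 + a = h + b" "h \<in> I" by blast
    then show ?thesis by simp
  qed
  show "I +>\<^bsub>poly_ring\<^esub> a = I +>\<^bsub>poly_ring\<^esub> b" if ab: "a - b \<in> I"
  proof -
    have "h + a = (h + (a - b)) + b" "h + b = (h - (a - b)) + a" for h by simp_all
    with ab I(2,5) show ?thesis unfolding coset by blast
  qed
qed

lemma coset_add:
  fixes I :: "('n::finite, 'k::field) mpoly set"
  assumes "ideal I poly_ring"
  shows "set_add poly_ring (I +>\<^bsub>poly_ring\<^esub> a) (I +>\<^bsub>poly_ring\<^esub> b) = I +>\<^bsub>poly_ring\<^esub> (a + b)"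
proof -
  interpret ideal I "poly_ring :: ('n, 'k) mpoly ring" by fact
  show ?thesis using a_rcos_sum[of a b] by simp
qed

lemma coset_smult:
  fixes I :: "('n::finite, 'k::field) mpoly set"
  assumes "ideal I poly_ring"
  shows "(\<Union>f \<in> I +>\<^bsub>poly_ring\<^esub> a. I +>\<^bsub>poly_ring\<^esub> (p * f)) = I +>\<^bsub>poly_ring\<^esub> (p * a)"
proof -
  note I = ideal_poly_ringD[OF assms]
  have coset: "I +>\<^bsub>poly_ring\<^esub> a = {h + a |h. h \<in> I}"
    by (auto simp: a_r_coset_def')
  have "I +>\<^bsub>poly_ring\<^esub> (p * f) = I +>\<^bsub>poly_ring\<^esub> (p * a)" if "f \<in> I +>\<^bsub>poly_ring\<^esub> a" for f
    using that I(3) unfolding coset coset_eq_iff[OF assms] by (auto simp: algebra_simps)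
  moreover have "0 + a \<in> I +>\<^bsub>poly_ring\<^esub> a" unfolding coset using I(1) by blast
  ultimately show ?thesis by blast
qed

lemma coset_zero:
  fixes I :: "('n::finite, 'k::field) mpoly set"
  shows "I +>\<^bsub>poly_ring\<^esub> 0 = I"
  by (simp add: a_r_coset_def')

lemma module_quotient_module:
  fixes I J :: "('n::finite, 'k::field) mpoly set"
  assumes I: "ideal I poly_ring" and J: "ideal J poly_ring"
  shows "Module.module poly_ring (quotient_module J I)"
proof -
  note simps = quotient_module_def coset_add[OF I] coset_smult[OF I]
  note J' = ideal_poly_ringD[OF J]
  have add: "(I +>\<^bsub>poly_ring\<^esub> a) \<oplus>\<^bsub>quotient_module J I\<^esub> (I +>\<^bsub>poly_ring\<^esub> b) =
      I +>\<^bsub>poly_ring\<^esub> (a + b)" for a b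
    by (simp add: simps)
  have smult: "p \<odot>\<^bsub>quotient_module J I\<^esub> (I +>\<^bsub>poly_ring\<^esub> a) = I +>\<^bsub>poly_ring\<^esub> (p * a)" for p a
    by (simp add: simps)
  have carr: "carrier (quotient_module J I) = (\<lambda>f. I +>\<^bsub>poly_ring\<^esub> f) ` J"
    by (simp add: quotient_module_def)
  have zero: "I = I +>\<^bsub>poly_ring\<^esub> 0" by (simp add: coset_zero)
  show ?thesis
  proof (rule Module.moduleI[OF cring_poly_ring])
    show "abelian_group (quotient_module J I)"
    proof (rule abelian_groupI)
      show "\<zero>\<^bsub>quotient_module J I\<^esub> \<in> carrier (quotient_module J I)"
        using J'(1) zero by (auto simp: quotient_module_def)
      show "\<zero>\<^bsub>quotient_module J I\<^esub> \<oplus>\<^bsub>quotient_module J I\<^esub> x = x"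
        if "x \<in> carrier (quotient_module J I)" for x
        using that coset_add[OF I, of 0] by (auto simp: quotient_module_def coset_zero)
      show "\<exists>y\<in>carrier (quotient_module J I).
              y \<oplus>\<^bsub>quotient_module J I\<^esub> x = \<zero>\<^bsub>quotient_module J I\<^esub>"
        if x: "x \<in> carrier (quotient_module J I)" for x
      proof -
        obtain f where "f \<in> J" "x = I +>\<^bsub>poly_ring\<^esub> f" using x by (auto simp: quotient_module_def)
        then show ?thesis
          by (intro bexI[of _ "I +>\<^bsub>poly_ring\<^esub> (- f)"])
            (use J'(4) in \<open>auto simp: simps coset_zero\<close>)
      qed
    qed (use J'(2) in \<open>auto simp: simps add_ac\<close>)
  qed (use J'(3) in \<open>auto simp: carr add smult distrib_left distrib_right mult.assoc\<close>)
qed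

lemma finsum_quotient_module:
  fixes I J :: "('n::finite, 'k::field) mpoly set"
  assumes I: "ideal I poly_ring" and J: "ideal J poly_ring"
    and "finite A" "\<And>x. x \<in> A \<Longrightarrow> f x \<in> J"
  shows "finsum (quotient_module J I) (\<lambda>x. I +>\<^bsub>poly_ring\<^esub> f x) A = I +>\<^bsub>poly_ring\<^esub> sum f A"
proof -
  interpret Q: Module.module poly_ring "quotient_module J I"
    by (rule module_quotient_module[OF I J])
  show ?thesis using assms(3,4)
  proof (induction A rule: finite_induct)
    case empty
    then show ?case by (simp add: coset_zero) (simp add: quotient_module_def)
  next
    case (insert x A)
    then have "(\<lambda>x. I +>\<^bsub>poly_ring\<^esub> f x) \<in> insert x A \<rightarrow> carrier (quotient_module J I)"
      by (auto simp: quotient_module_def)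
    moreover have "(I +>\<^bsub>poly_ring\<^esub> a) \<oplus>\<^bsub>quotient_module J I\<^esub> (I +>\<^bsub>poly_ring\<^esub> b) =
        I +>\<^bsub>poly_ring\<^esub> (a + b)" for a b
      by (simp add: quotient_module_def coset_add[OF I])
    ultimately show ?case using insert by (simp add: Q.finsum_insert)
  qed
qed

definition homogeneous_part :: "('n::finite \<Rightarrow> int) \<Rightarrow> ('n, 'k::field) mpoly \<Rightarrow> ('n, 'k) mpoly" where
  "homogeneous_part g f =
     (\<Sum>t \<in> {t \<in> Poly_Mapping.keys f. (\<lambda>i. int (Poly_Mapping.lookup t i)) = g}.
        Poly_Mapping.single t (Poly_Mapping.lookup f t))"

lemma lookup_homogeneous_part:
  "Poly_Mapping.lookup (homogeneous_part g f) t =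
     (if (\<lambda>i. int (Poly_Mapping.lookup t i)) = g then Poly_Mapping.lookup f t else 0)"
  by (auto simp: homogeneous_part_def lookup_sum lookup_single when_def sum.delta' in_keys_iff)

lemma homogeneous_polys_iff:
  "f \<in> homogeneous_polys g \<longleftrightarrow>
     (\<forall>t. Poly_Mapping.lookup f t \<noteq> 0 \<longrightarrow> (\<lambda>i. int (Poly_Mapping.lookup t i)) = g)"
  by (auto simp: homogeneous_polys_def in_keys_iff fun_eq_iff)

lemma homogeneous_part_in: "homogeneous_part g f \<in> homogeneous_polys g"
  by (auto simp: homogeneous_polys_iff lookup_homogeneous_part)

lemma homogeneous_part_in_monomial_ideal:
  "monomial_ideal I \<Longrightarrow> f \<in> I \<Longrightarrow> homogeneous_part g f \<in> I"
  unfolding monomial_ideal_iff[of I f] monomial_ideal_iff[of I "homogeneous_part g f"]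
  by (auto simp: in_keys_iff lookup_homogeneous_part split: if_splits)

lemma homogeneous_part_homogeneous:
  "f \<in> homogeneous_polys g \<Longrightarrow> homogeneous_part h f = (if h = g then f else 0)"
  by (intro poly_mapping_eqI) (auto simp: homogeneous_polys_iff lookup_homogeneous_part)

lemma homogeneous_part_sum: "homogeneous_part g (sum f A) = (\<Sum>x\<in>A. homogeneous_part g (f x))"
  by (rule poly_mapping_eqI) (simp add: lookup_homogeneous_part lookup_sum)

lemma homogeneous_part_diff:
  "homogeneous_part g (a - b) = homogeneous_part g a - homogeneous_part g b"
  by (rule poly_mapping_eqI) (simp add: lookup_homogeneous_part lookup_minus)

lemma homogeneous_part_support:
  "{g. homogeneous_part g f \<noteq> 0} \<subseteq> (\<lambda>t i. int (Poly_Mapping.lookup t i)) ` Poly_Mapping.keys f"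
proof
  fix g assume "g \<in> {g. homogeneous_part g f \<noteq> 0}"
  then obtain t where "Poly_Mapping.lookup (homogeneous_part g f) t \<noteq> 0"
    by (auto simp: poly_mapping_eq_iff fun_eq_iff)
  then show "g \<in> (\<lambda>t i. int (Poly_Mapping.lookup t i)) ` Poly_Mapping.keys f"
    by (auto simp: lookup_homogeneous_part in_keys_iff split: if_splits)
qed

lemma sum_homogeneous_parts:
  fixes f :: "('n::finite, 'k::field) mpoly"
  assumes "finite A" "{g. homogeneous_part g f \<noteq> 0} \<subseteq> A"
  shows "(\<Sum>g\<in>A. homogeneous_part g f) = f"
proof (rule poly_mapping_eqI)
  fix t :: "'n \<Rightarrow>\<^sub>0 nat"
  let ?g = "\<lambda>i. int (Poly_Mapping.lookup t i)"
  have "Poly_Mapping.lookup f t = 0" if "?g \<notin> A"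
  proof -
    have "homogeneous_part ?g f = 0" using that assms(2) by blast
    then show ?thesis by (metis lookup_homogeneous_part lookup_zero)
  qed
  then show "Poly_Mapping.lookup (\<Sum>g\<in>A. homogeneous_part g f) t = Poly_Mapping.lookup f t"
    using assms(1) by (auto simp: lookup_sum lookup_homogeneous_part sum.delta)
qed

lemma multigraded_module_quotient_module:
  fixes I J :: "('n::finite, 'k::field) mpoly set"
  assumes "monomial_ideal I" "monomial_ideal J" "I \<subseteq> J"
  shows "multigraded_module (quotient_module J I)"
proof -
  note I = monomial_ideal_imp_ideal[OF assms(1)] and J = monomial_ideal_imp_ideal[OF assms(2)]
  note I' = ideal_poly_ringD[OF I] and J' = ideal_poly_ringD[OF J]
  let ?M = "quotient_module J I"
  let ?c = "\<lambda>f. I +>\<^bsub>poly_ring\<^esub> f"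
  interpret Module.module poly_ring ?M by (rule module_quotient_module[OF I J])
  have comp: "component ?M g = ?c ` (J \<inter> homogeneous_polys g)" for g
    by (simp add: quotient_module_def)
  have carr: "carrier ?M = ?c ` J" and zero: "\<zero>\<^bsub>?M\<^esub> = I"
    by (simp_all add: quotient_module_def)
  have add: "?c a \<oplus>\<^bsub>?M\<^esub> ?c b = ?c (a + b)" for a b
    by (simp add: quotient_module_def coset_add[OF I])
  have hadd: "a + b \<in> homogeneous_polys g"
    if "a \<in> homogeneous_polys g" "b \<in> homogeneous_polys g" for a b :: "('n, 'k) mpoly" and g
    using that Poly_Mapping.keys_add[of a b] by (fastforce simp: homogeneous_polys_def)
  have hzero: "(0 :: ('n, 'k) mpoly) \<in> homogeneous_polys g" for g
    by (simp add: homogeneous_polys_def)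
  have hmin: "- a \<in> homogeneous_polys g" if "a \<in> homogeneous_polys g" for a :: "('n, 'k) mpoly" and g
    using that by (simp add: homogeneous_polys_iff)
  have hmult: "p * a \<in> homogeneous_polys (\<lambda>i. g i + h i)"
    if "p \<in> homogeneous_polys g" "a \<in> homogeneous_polys h" for p a :: "('n, 'k) mpoly" and g h
    using that keys_mult[of p a] by (fastforce simp: homogeneous_polys_def lookup_add)
  show ?thesis
  proof (intro multigraded_module.intro multigraded_module_axioms.intro, goal_cases)
    case 1
    show ?case by (rule module_quotient_module[OF I J])
  next
    case (2 g)
    show ?case
    proof (rule M.add.subgroupI)
      show "component ?M g \<subseteq> carrier ?M" by (auto simp: comp carr)
      show "component ?M g \<noteq> {}" using hzero J'(1) by (auto simp: comp)
      show "x \<oplus>\<^bsub>?M\<^esub> y \<in> component ?M g" if "x \<in> component ?M g" "y \<in> component ?M g" for x y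
        using that hadd J'(2) by (auto simp: comp add)
      show "\<ominus>\<^bsub>?M\<^esub> x \<in> component ?M g" if x: "x \<in> component ?M g" for x
      proof -
        obtain a where a: "x = ?c a" "a \<in> J" "a \<in> homogeneous_polys g" using x by (auto simp: comp)
        have "\<ominus>\<^bsub>?M\<^esub> x = ?c (- a)"
          by (rule M.minus_equality) (use a J'(4) in \<open>auto simp: carr add zero coset_zero\<close>)
        then show ?thesis using a hmin J'(4) by (auto simp: comp)
      qed
    qed
  next
    case (3 x)
    then obtain f where f: "x = ?c f" "f \<in> J" by (auto simp: carr)
    define u where "u = (\<lambda>g. ?c (homogeneous_part g f))"
    have supp: "finite {g. homogeneous_part g f \<noteq> 0}"
      using homogeneous_part_support finite_imageI[OF finite_keys] by (rule finite_subset)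
    show ?case
    proof (rule ex1I[of _ u], intro conjI allI)
      show "u g \<in> component ?M g" for g
        using homogeneous_part_in homogeneous_part_in_monomial_ideal[OF assms(2) f(2)]
        by (auto simp: u_def comp)
      have sub: "{g. u g \<noteq> \<zero>\<^bsub>?M\<^esub>} \<subseteq> {g. homogeneous_part g f \<noteq> 0}"
        by (auto simp: u_def zero coset_zero)
      then show fin: "finite {g. u g \<noteq> \<zero>\<^bsub>?M\<^esub>}" using supp by (rule finite_subset)
      have uc: "u \<in> UNIV \<rightarrow> carrier ?M"
        using homogeneous_part_in_monomial_ideal[OF assms(2) f(2)] by (auto simp: u_def carr)
      have "finsum ?M u {g. u g \<noteq> \<zero>\<^bsub>?M\<^esub>} = finsum ?M u {g. homogeneous_part g f \<noteq> 0}"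
        using sub supp uc by (intro M.add.finprod_mono_neutral_cong_left) auto
      also have "\<dots> = ?c (\<Sum>g \<in> {g. homogeneous_part g f \<noteq> 0}. homogeneous_part g f)"
        unfolding u_def
        by (rule finsum_quotient_module[OF I J supp])
          (rule homogeneous_part_in_monomial_ideal[OF assms(2) f(2)])
      also have "\<dots> = x" using sum_homogeneous_parts[OF supp order_refl] f(1) by simp
      finally show "x = finsum ?M u {g. u g \<noteq> \<zero>\<^bsub>?M\<^esub>}" by simp
    next
      fix v assume v: "(\<forall>g. v g \<in> component ?M g) \<and> finite {g. v g \<noteq> \<zero>\<^bsub>?M\<^esub>} \<and>
        x = finsum ?M v {g. v g \<noteq> \<zero>\<^bsub>?M\<^esub>}"
      let ?V = "{g. v g \<noteq> \<zero>\<^bsub>?M\<^esub>}"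
      have "\<forall>g. \<exists>a. a \<in> J \<and> a \<in> homogeneous_polys g \<and> v g = ?c a" using v by (auto simp: comp)
      then obtain a where a: "\<And>g. a g \<in> J" "\<And>g. a g \<in> homogeneous_polys g" "\<And>g. v g = ?c (a g)"
        by metis
      have fin: "finite ?V" using v by blast
      have "?c f = finsum ?M (\<lambda>g. ?c (a g)) ?V"
        using v f(1) a(3) by (metis (no_types, lifting) ext)
      also have "\<dots> = ?c (sum a ?V)"
        by (rule finsum_quotient_module[OF I J fin a(1)])
      finally have d: "f - sum a ?V \<in> I" by (simp add: coset_eq_iff[OF I])
      show "v = u"
      proof
        fix g
        have hp: "homogeneous_part g (sum a ?V) = (if g \<in> ?V then a g else 0)"
          using fin by (simp add: homogeneous_part_sum homogeneous_part_homogeneous[OF a(2)] sum.delta)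
        have "homogeneous_part g f - (if g \<in> ?V then a g else 0) \<in> I"
          using homogeneous_part_in_monomial_ideal[OF assms(1) d, of g]
          unfolding homogeneous_part_diff hp .
        then have "u g = ?c (if g \<in> ?V then a g else 0)"
          by (simp add: u_def coset_eq_iff[OF I])
        then show "v g = u g"
          using a(3)[of g] by (auto simp: zero coset_zero)
      qed
    qed
  next
    case (4 p g x h)
    then show ?case
      using hmult J'(3) by (auto simp: comp) (auto simp: quotient_module_def coset_smult[OF I])
  qed
qed

end

(* Stanley decompositions of J/I correspond to partitions of the set B of exponents of monomials
   in J - I into cones a + N^Z. For all large N, x^b lies in the radical of I iff x^(N b) lies in I,
   and likewise for J, so the exponent set of the quotient of the radicals is the preimage of B
   under b |-> N b. The preimage of a cone a + N^Z is empty or again a cone in the same directions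
   Z, so a partition of B pulls back to one with at most as many parts. *)

theory Submission
  imports Defs
begin

text \<open>Each multidegree of \<open>S\<close> contains at most one monomial, so the generators of
  a Stanley decomposition are classes of scalar multiples of monomials; this is what turns the
  algebraic question into one about exponents. Two points need care. The radical is defined through
  arbitrary polynomials, so it must be shown to be generated by monomials before the correspondence
  applies to it. This is done with a term of \<open>f\<close> whose powers survive in every power of
  \<open>f\<close>. Moreover, one \<open>N\<close> must serve both ideals and all exponents at once.
  It exists because membership of \<open>x^b\<close> in a radical depends only on which variables
  occur in \<open>x^b\<close>, and there are finitely many sets of variables. Under the preimage a
  part may be lost but is never split, which gives the direction of the inequality.\<close>

section \<open>Monomial multiples and dilation of exponents\<close>

lemma lookup_single_times:
  fixes p :: "('n::finite, 'k::field) mpoly"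
  shows "Poly_Mapping.lookup (Poly_Mapping.single a c * p) (a + s) = c * Poly_Mapping.lookup p s"
proof -
  have "Poly_Mapping.single a c * p =
      (\<Sum>t \<in> Poly_Mapping.keys p. Poly_Mapping.single (a + t) (c * Poly_Mapping.lookup p t))"
    by (subst poly_mapping_eq_sum_terms[of p]) (simp add: sum_distrib_left mult_single)
  then show ?thesis
    by (auto simp: lookup_sum lookup_single when_def sum.delta' in_keys_iff)
qed

lemma in_keys_single_times:
  fixes p :: "('n::finite, 'k::field) mpoly"
  assumes "t \<in> Poly_Mapping.keys (Poly_Mapping.single a c * p)"
  obtains s where "t = a + s" "s \<in> Poly_Mapping.keys p"
  using keys_mult[of "Poly_Mapping.single a c" p] assms by (auto split: if_splits)

lemma polys_in_diff:
  assumes "p \<in> polys_in Z" "q \<in> polys_in Z"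
  shows "p - q \<in> polys_in Z"
  using assms keys_diff[of p q] unfolding polys_in_def by blast

definition scale_exponent :: "nat \<Rightarrow> ('n \<Rightarrow>\<^sub>0 nat) \<Rightarrow> ('n \<Rightarrow>\<^sub>0 nat)" where
  "scale_exponent N t = Poly_Mapping.map ((*) N) t"

lemma lookup_scale_exponent [simp]:
  "Poly_Mapping.lookup (scale_exponent N t) i = N * Poly_Mapping.lookup t i"
  by (simp add: scale_exponent_def Poly_Mapping.map.rep_eq when_def)

lemma scale_exponent_0 [simp]: "scale_exponent 0 t = 0"
  by (rule poly_mapping_eqI) simp

lemma scale_exponent_Suc: "scale_exponent (Suc N) t = t + scale_exponent N t"
  by (rule poly_mapping_eqI) (simp add: lookup_add)

lemma monomial_power:
  "(Poly_Mapping.single t 1 :: ('n::finite, 'k::field) mpoly) ^ N =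
     Poly_Mapping.single (scale_exponent N t) 1"
  by (induction N) (simp_all add: scale_exponent_Suc mult_single)

lemma ideal_monomial_mono:
  fixes I :: "('n::finite, 'k::field) mpoly set"
  assumes "ideal I poly_ring" "Poly_Mapping.single s 1 \<in> I"
    and "\<And>i. Poly_Mapping.lookup s i \<le> Poly_Mapping.lookup t i"
  shows "Poly_Mapping.single t 1 \<in> I"
proof -
  \<comment> \<open>Subtraction of exponents is truncated at zero; the assumed inequality makes it
    exact, so \<open>x^s\<close> divides \<open>x^t\<close>.\<close>
  have "t = (t - s) + s"
    by (rule poly_mapping_eqI) (simp add: lookup_add lookup_minus assms(3))
  then have "(Poly_Mapping.single t 1 :: ('n, 'k) mpoly) =
      Poly_Mapping.single (t - s) 1 * Poly_Mapping.single s 1"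
    by (simp add: mult_single)
  then show ?thesis using ideal_poly_ringD(3)[OF assms(1,2)] by simp
qed

section \<open>The radical of a monomial ideal is a monomial ideal\<close>

text \<open>In the binomial expansion of \<open>(a + b) ^ (k + l)\<close> every term contains
  \<open>a\<close> to a power at least \<open>k\<close> or \<open>b\<close> to a power at least
  \<open>l\<close>.\<close>

lemma ideal_ideal_radical:
  fixes I :: "('n::finite, 'k::field) mpoly set"
  assumes I: "ideal I poly_ring"
  shows "ideal (ideal_radical I) poly_ring"
proof (rule ideal_poly_ringI)
  note I' = ideal_poly_ringD[OF I]
  show "0 \<in> ideal_radical I"
    using I'(1) by (auto simp: ideal_radical_def intro: exI[of _ 1])
  show "p * a \<in> ideal_radical I" if "a \<in> ideal_radical I" for a p
    using that I'(3) by (auto simp: ideal_radical_def power_mult_distrib)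
  show "a + b \<in> ideal_radical I" if ab: "a \<in> ideal_radical I" "b \<in> ideal_radical I" for a b
  proof -
    from ab obtain k l where kl: "k > 0" "a ^ k \<in> I" "b ^ l \<in> I"
      by (auto simp: ideal_radical_def)
    have "of_nat ((k + l) choose i) * a ^ i * b ^ (k + l - i) \<in> I" if "i \<le> k + l" for i
    proof (cases "k \<le> i")
      case True
      then have "a ^ i = a ^ (i - k) * a ^ k" by (simp flip: power_add)
      then show ?thesis using I'(3)[OF kl(2), of "of_nat ((k + l) choose i) * b ^ (k + l - i) * a ^ (i - k)"]
        by (simp add: mult_ac)
    next
      case False
      then have "b ^ (k + l - i) = b ^ (k - i) * b ^ l" by (simp flip: power_add)
      then show ?thesis using I'(3)[OF kl(3), of "of_nat ((k + l) choose i) * a ^ i * b ^ (k - i)"]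
        by (simp add: mult_ac)
    qed
    then have "(a + b) ^ (k + l) \<in> I"
      unfolding binomial_ring by (intro ideal_poly_ring_sum[OF I]) auto
    then show ?thesis using kl(1) unfolding ideal_radical_def
      by (intro CollectI exI[of _ "k + l"]) simp
  qed
qed

text \<open>Positional notation: each new variable receives a weight larger than every weighted sum
  of the previous ones. Such a weight selects a unique leading term, which cannot cancel in
  powers.\<close>

lemma exists_injective_weight:
  fixes T :: "('n::finite \<Rightarrow>\<^sub>0 nat) set"
  assumes "finite T"
  shows "\<exists>c :: 'n \<Rightarrow> nat. inj_on (\<lambda>t. \<Sum>i\<in>UNIV. c i * Poly_Mapping.lookup t i) T"
proof -
  have "\<exists>c :: 'n \<Rightarrow> nat. \<forall>s\<in>T. \<forall>t\<in>T.
      (\<Sum>i\<in>V. c i * Poly_Mapping.lookup s i) = (\<Sum>i\<in>V. c i * Poly_Mapping.lookup t i) \<longrightarrow>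
      (\<forall>i\<in>V. Poly_Mapping.lookup s i = Poly_Mapping.lookup t i)" for V :: "'n set"
    using finite[of V]
  proof (induction V rule: finite_induct)
    case empty
    then show ?case by simp
  next
    case (insert v V)
    then obtain c :: "'n \<Rightarrow> nat" where c: "\<And>s t. s \<in> T \<Longrightarrow> t \<in> T \<Longrightarrow>
      (\<Sum>i\<in>V. c i * Poly_Mapping.lookup s i) = (\<Sum>i\<in>V. c i * Poly_Mapping.lookup t i) \<Longrightarrow>
      (\<forall>i\<in>V. Poly_Mapping.lookup s i = Poly_Mapping.lookup t i)" by blast
    let ?w = "\<lambda>t. \<Sum>i\<in>V. c i * Poly_Mapping.lookup t i"
    \<comment> \<open>Inserting 0 keeps \<open>Max\<close> defined when \<open>T\<close> is
      empty.\<close>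
    define M where "M = Suc (Max (insert 0 (?w ` T)))"
    have M: "?w t < M" if "t \<in> T" for t
      using that assms by (auto simp: M_def less_Suc_eq_le)
    let ?c = "c(v := M)"
    have eq: "(\<Sum>i\<in>insert v V. ?c i * Poly_Mapping.lookup t i) = M * Poly_Mapping.lookup t v + ?w t" for t
    proof -
      have "(\<Sum>i\<in>V. ?c i * Poly_Mapping.lookup t i) = ?w t"
        using insert(2) by (intro sum.cong) auto
      then show ?thesis using insert(1,2) by simp
    qed
    have "\<forall>i\<in>insert v V. Poly_Mapping.lookup s i = Poly_Mapping.lookup t i"
      if st: "s \<in> T" "t \<in> T"
        and e: "M * Poly_Mapping.lookup s v + ?w s = M * Poly_Mapping.lookup t v + ?w t" for s t
    proof -
      \<comment> \<open>The old weighted sum is the remainder modulo \<open>M\<close>, the entry at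
        \<open>v\<close> the quotient.\<close>
      have "?w s = (M * Poly_Mapping.lookup s v + ?w s) mod M" using M[OF st(1)] by simp
      also have "\<dots> = ?w t" unfolding e using M[OF st(2)] by simp
      finally have w: "?w s = ?w t" .
      have "M > 0" by (simp add: M_def)
      with e w have "Poly_Mapping.lookup s v = Poly_Mapping.lookup t v" by simp
      then show ?thesis using c[OF st w] by simp
    qed
    then show ?case by (intro exI[of _ ?c]) (unfold eq, blast)
  qed
  from this[of UNIV] show ?thesis
    unfolding inj_on_def by (metis UNIV_I poly_mapping_eqI)
qed

text \<open>The exponent is that of the leading term for a generic weight.\<close>

lemma exists_extremal_exponent:
  fixes f :: "('n::finite, 'k::field) mpoly"
  assumes "f \<noteq> 0"
  obtains t where "t \<in> Poly_Mapping.keys f"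
    "\<And>k. scale_exponent k t \<in> Poly_Mapping.keys (f ^ k)"
proof -
  obtain c :: "'n \<Rightarrow> nat" where
    "inj_on (\<lambda>t. \<Sum>i\<in>UNIV. c i * Poly_Mapping.lookup t i) (Poly_Mapping.keys f)"
    using exists_injective_weight[of "Poly_Mapping.keys f"] by auto
  define w where "w = (\<lambda>t. \<Sum>i\<in>UNIV. c i * Poly_Mapping.lookup t i)"
  have inj: "inj_on w (Poly_Mapping.keys f)" unfolding w_def by fact
  have w_add: "w (s + t) = w s + w t" for s t
    by (simp add: w_def lookup_add distrib_left sum.distrib)
  have ne: "Poly_Mapping.keys f \<noteq> {}"
    using assms by (metis in_keys_iff ex_in_conv lookup_zero poly_mapping_eqI)
  have "Max (w ` Poly_Mapping.keys f) \<in> w ` Poly_Mapping.keys f"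
    using ne by (intro Max_in) auto
  then obtain t where t: "t \<in> Poly_Mapping.keys f" "w t = Max (w ` Poly_Mapping.keys f)"
    by (metis imageE)
  have max: "w s \<le> w t" if "s \<in> Poly_Mapping.keys f" for s
    using that t(2) by simp
  \<comment> \<open>The bound on the weights of all terms of \<open>f ^ k\<close> is carried along
    in the induction because it excludes cancellation in the next power.\<close>
  have "(\<forall>s \<in> Poly_Mapping.keys (f ^ k). w s \<le> w (scale_exponent k t)) \<and>
      scale_exponent k t \<in> Poly_Mapping.keys (f ^ k)" for k
  proof (induction k)
    case 0
    then show ?case by simp
  next
    case (Suc k)
    have le: "w s \<le> w (scale_exponent (Suc k) t)" if "s \<in> Poly_Mapping.keys (f ^ Suc k)" for s
      using that keys_mult[of f "f ^ k"] Suc max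
      by (fastforce simp: scale_exponent_Suc w_add intro: add_mono)
    let ?g = "f - Poly_Mapping.single t (Poly_Mapping.lookup f t)"
    \<comment> \<open>Both factors obey a weight bound, and a product of terms with this exponent
      would attain both bounds. By injectivity the first factor would then have exponent
      \<open>t\<close>, which was removed from \<open>?g\<close>.\<close>
    have "scale_exponent (Suc k) t \<notin> Poly_Mapping.keys (?g * f ^ k)"
    proof
      assume "scale_exponent (Suc k) t \<in> Poly_Mapping.keys (?g * f ^ k)"
      then obtain r s where rs: "t + scale_exponent k t = r + s" "r \<in> Poly_Mapping.keys ?g"
        "s \<in> Poly_Mapping.keys (f ^ k)"
        using keys_mult[of ?g "f ^ k"] by (auto simp: scale_exponent_Suc)
      from rs(2) have r: "r \<in> Poly_Mapping.keys f" "r \<noteq> t"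
        by (auto simp: in_keys_iff lookup_minus lookup_single when_def split: if_splits)
      have "w s \<le> w (scale_exponent k t)" using Suc rs(3) by blast
      moreover have "w t + w (scale_exponent k t) = w r + w s"
        using rs(1) by (metis w_add)
      ultimately have "w r = w t" using max[OF r(1)] by linarith
      then show False using inj_onD[OF inj _ r(1) t(1)] r(2) by blast
    qed
    then have "Poly_Mapping.lookup (?g * f ^ k) (scale_exponent (Suc k) t) = 0"
      by (simp add: in_keys_iff)
    moreover have "f ^ Suc k =
        ?g * f ^ k + Poly_Mapping.single t (Poly_Mapping.lookup f t) * f ^ k"
      by (simp add: algebra_simps)
    ultimately have "Poly_Mapping.lookup (f ^ Suc k) (scale_exponent (Suc k) t) =
        Poly_Mapping.lookup f t * Poly_Mapping.lookup (f ^ k) (scale_exponent k t)"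
      by (simp add: lookup_add scale_exponent_Suc lookup_single_times)
    then have "scale_exponent (Suc k) t \<in> Poly_Mapping.keys (f ^ Suc k)"
      using Suc t(1) by (simp add: in_keys_iff)
    with le show ?case by blast
  qed
  then show ?thesis using that t(1) by blast
qed

text \<open>If \<open>f ^ k\<close> lies in \<open>I\<close> and \<open>t\<close> is an extremal
  exponent of \<open>f\<close>, then \<open>x^(k t)\<close> occurs in \<open>f ^ k\<close>, hence
  lies in \<open>I\<close>, so \<open>x^t\<close> is in the radical. Subtracting this term from
  \<open>f\<close> stays in the radical and leaves fewer terms.\<close>

lemma monomial_ideal_ideal_radical:
  fixes I :: "('n::finite, 'k::field) mpoly set"
  assumes "monomial_ideal I"
  shows "monomial_ideal (ideal_radical I)"
proof -
  note I = monomial_ideal_imp_ideal[OF assms]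
  note R = ideal_ideal_radical[OF I]
  define A :: "('n \<Rightarrow>\<^sub>0 nat) set" where "A = {t. Poly_Mapping.single t 1 \<in> ideal_radical I}"
  define G where "G = genideal poly_ring ((\<lambda>t. Poly_Mapping.single t (1::'k)) ` A)"
  note G = PR.genideal_ideal[of "(\<lambda>t. Poly_Mapping.single t (1::'k)) ` A", folded G_def, simplified]
  have "f \<in> G" if "f \<in> ideal_radical I" for f
    using that
  proof (induction "card (Poly_Mapping.keys f)" arbitrary: f rule: less_induct)
    case less
    show ?case
    proof (cases "f = 0")
      case True
      then show ?thesis using ideal_poly_ringD(1)[OF G] by simp
    next
      case False
      then obtain t where t: "t \<in> Poly_Mapping.keys f"
        "\<And>k. scale_exponent k t \<in> Poly_Mapping.keys (f ^ k)"
        using exists_extremal_exponent by blast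
      obtain k where k: "k > 0" "f ^ k \<in> I" using less(2) by (auto simp: ideal_radical_def)
      have "Poly_Mapping.single (scale_exponent k t) 1 \<in> I"
        using monomial_ideal_iff[OF assms, THEN iffD1, OF k(2)] t(2) by (rule bspec)
      then have tR: "Poly_Mapping.single t 1 \<in> ideal_radical I"
        using k(1) by (auto simp: ideal_radical_def monomial_power)
      let ?m = "Poly_Mapping.single t (Poly_Mapping.lookup f t)"
      have m: "?m = Poly_Mapping.single 0 (Poly_Mapping.lookup f t) * Poly_Mapping.single t 1"
        by (simp add: mult_single)
      have mR: "?m \<in> ideal_radical I"
        unfolding m by (rule ideal_poly_ringD(3)[OF R tR])
      have lookup: "Poly_Mapping.lookup (f - ?m) s = (if s = t then 0 else Poly_Mapping.lookup f s)" for s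
        by (simp add: lookup_minus lookup_single when_def)
      have "Poly_Mapping.keys (f - ?m) = Poly_Mapping.keys f - {t}"
        unfolding set_eq_iff Diff_iff in_keys_iff lookup by simp
      then have "card (Poly_Mapping.keys (f - ?m)) < card (Poly_Mapping.keys f)"
        using card_Diff1_less[OF finite_keys t(1)] by (simp only:)
      then have "f - ?m \<in> G" using ideal_poly_ringD(5)[OF R less(2) mR] by (rule less(1))
      moreover have "Poly_Mapping.single t 1 \<in> G"
        using PR.genideal_self[of "(\<lambda>t. Poly_Mapping.single t (1::'k)) ` A"] tR
        unfolding G_def A_def by (simp add: image_subset_iff)
      then have "?m \<in> G" unfolding m by (rule ideal_poly_ringD(3)[OF G])
      ultimately have "(f - ?m) + ?m \<in> G" by (rule ideal_poly_ringD(2)[OF G])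
      then show ?thesis by simp
    qed
  qed
  moreover have "G \<subseteq> ideal_radical I"
    unfolding G_def by (rule PR.genideal_minimal[OF R]) (auto simp: A_def)
  ultimately have "ideal_radical I = G" by blast
  then show ?thesis unfolding monomial_ideal_def G_def by blast
qed

section \<open>One exponent for all monomials in the radical\<close>

text \<open>For each set \<open>F\<close> of variables a single monomial in the radical with support
  \<open>F\<close> yields an exponent good for all monomials with that support; finitely many
  \<open>F\<close> occur. Allowing all \<open>N\<close> beyond a bound lets two ideals share one
  \<open>N\<close>.\<close>

lemma ideal_radical_uniform_exponent:
  fixes I :: "('n::finite, 'k::field) mpoly set"
  assumes I: "ideal I poly_ring"
  shows "\<exists>N0. \<forall>N\<ge>N0. \<forall>t. Poly_Mapping.single t 1 \<in> ideal_radical I \<longrightarrow>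
    Poly_Mapping.single (scale_exponent N t) 1 \<in> I"
proof -
  have "\<exists>N. \<forall>t. Poly_Mapping.keys t = F \<longrightarrow> Poly_Mapping.single t 1 \<in> ideal_radical I \<longrightarrow>
      Poly_Mapping.single (scale_exponent N t) 1 \<in> I" for F :: "'n set"
  proof (cases "\<exists>s. Poly_Mapping.keys s = F \<and>
      (Poly_Mapping.single s 1 :: ('n, 'k) mpoly) \<in> ideal_radical I")
    case True
    then obtain s k where s: "Poly_Mapping.keys s = F"
      "(Poly_Mapping.single (scale_exponent k s) 1 :: ('n, 'k) mpoly) \<in> I"
      by (auto simp: ideal_radical_def monomial_power)
    \<comment> \<open>Every exponent \<open>t\<close> with support \<open>F\<close> has entries at
      least 1 on \<open>F\<close>, so \<open>N t\<close> dominates \<open>k s\<close> there; off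
      \<open>F\<close> both vanish.\<close>
    define N where "N = Max (range (\<lambda>i. k * Poly_Mapping.lookup s i))"
    have N: "k * Poly_Mapping.lookup s i \<le> N" for i
      unfolding N_def by (rule Max_ge) auto
    have "Poly_Mapping.single (scale_exponent N t) 1 \<in> I" if t: "Poly_Mapping.keys t = F" for t
    proof (rule ideal_monomial_mono[OF I s(2)])
      fix i
      show "Poly_Mapping.lookup (scale_exponent k s) i \<le> Poly_Mapping.lookup (scale_exponent N t) i"
      proof (cases "i \<in> F")
        case True
        then have "Poly_Mapping.lookup t i \<ge> 1" using t by (auto simp: in_keys_iff)
        then have "N \<le> N * Poly_Mapping.lookup t i" by simp
        with N[of i] have "k * Poly_Mapping.lookup s i \<le> N * Poly_Mapping.lookup t i"
          by (rule order_trans)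
        then show ?thesis by simp
      next
        case False
        then show ?thesis using s(1) by (auto simp: in_keys_iff)
      qed
    qed
    then show ?thesis by blast
  qed blast
  then obtain N where N: "\<And>t. Poly_Mapping.single t 1 \<in> ideal_radical I \<Longrightarrow>
      Poly_Mapping.single (scale_exponent (N (Poly_Mapping.keys t)) t) 1 \<in> I" by metis
  show ?thesis
  \<comment> \<open>Here \<open>N\<close> assigns an exponent to each support, and its range is
    finite since there are finitely many sets of variables.\<close>
  proof (intro exI[of _ "Max (range N)"] allI impI)
    fix M t assume M: "Max (range N) \<le> M"
      and t: "(Poly_Mapping.single t 1 :: ('n, 'k) mpoly) \<in> ideal_radical I"
    have "N (Poly_Mapping.keys t) \<le> M"
      using M by (simp add: Max_le_iff)
    then show "Poly_Mapping.single (scale_exponent M t) 1 \<in> I"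
      by (intro ideal_monomial_mono[OF I N[OF t]]) simp
  qed
qed

section \<open>Cones of exponents and their preimages under dilation\<close>

text \<open>These are the exponents of the monomials in \<open>x^a K[Z]\<close>. Apex and directions
  form a pair so that a list of cones mirrors the list in a Stanley decomposition.\<close>

definition exponent_cone :: "('n::finite \<Rightarrow>\<^sub>0 nat) \<times> 'n set \<Rightarrow> ('n \<Rightarrow>\<^sub>0 nat) set" where
  "exponent_cone = (\<lambda>(a, Z). {a + s |s. Poly_Mapping.keys s \<subseteq> Z})"

text \<open>Membership is a condition on each coordinate separately, so the preimage under dilation
  can be computed one coordinate at a time.\<close>

lemma exponent_cone_iff:
  "t \<in> exponent_cone (a, Z) \<longleftrightarrow>
     (\<forall>i. Poly_Mapping.lookup a i \<le> Poly_Mapping.lookup t i \<and>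
          (i \<notin> Z \<longrightarrow> Poly_Mapping.lookup t i = Poly_Mapping.lookup a i))"
proof
  show "t \<in> exponent_cone (a, Z)"
    if *: "\<forall>i. Poly_Mapping.lookup a i \<le> Poly_Mapping.lookup t i \<and>
          (i \<notin> Z \<longrightarrow> Poly_Mapping.lookup t i = Poly_Mapping.lookup a i)"
  proof -
    have "t = a + (t - a)"
      by (rule poly_mapping_eqI) (simp add: lookup_add lookup_minus *)
    moreover have "Poly_Mapping.keys (t - a) \<subseteq> Z"
      using * by (auto simp: in_keys_iff lookup_minus)
    ultimately show ?thesis unfolding exponent_cone_def by blast
  qed
qed (auto simp: exponent_cone_def lookup_add in_keys_iff)

text \<open>Disjointness is between positions of the list. As cones are nonempty, no cone can be
  repeated, and the length is the number of parts.\<close>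

definition cone_partition ::
    "('n::finite \<Rightarrow>\<^sub>0 nat) set \<Rightarrow> (('n \<Rightarrow>\<^sub>0 nat) \<times> 'n set) list \<Rightarrow> bool" where
  "cone_partition B E \<longleftrightarrow> \<Union> (exponent_cone ` set E) = B \<and>
     sorted_wrt (\<lambda>x y. exponent_cone x \<inter> exponent_cone y = {}) E"

text \<open>The apex of the preimage is rounded up. If the preimage is nonempty, then \<open>N\<close> divides the
  entries of \<open>a\<close> outside \<open>Z\<close>, so that nothing is rounded there.\<close>

lemma scale_exponent_vimage_cone:
  assumes "N > 0"
  shows "\<exists>a'. scale_exponent N -` exponent_cone (a, Z) \<in> {{}, exponent_cone (a', Z)}"
proof (cases "scale_exponent N -` exponent_cone (a, Z) = {}")
  case False
  then obtain s where s: "scale_exponent N s \<in> exponent_cone (a, Z)" by blast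
  define a' where "a' = Poly_Mapping.map (\<lambda>x. (x + N - 1) div N) a"
  \<comment> \<open>\<open>Poly_Mapping.map\<close> keeps zero entries zero; the formula agrees
    there because \<open>(N - 1) div N = 0\<close>.\<close>
  have a': "Poly_Mapping.lookup a' i = (Poly_Mapping.lookup a i + N - 1) div N" for i
    using assms by (simp add: a'_def Poly_Mapping.map.rep_eq when_def)
  \<comment> \<open>The defining property of the ceiling of \<open>a_i / N\<close>, which transfers
    the lower bounds of the cone.\<close>
  have ge: "Poly_Mapping.lookup a' i \<le> x \<longleftrightarrow> Poly_Mapping.lookup a i \<le> N * x" for i x
  proof -
    have "(Poly_Mapping.lookup a i + N - 1) div N < Suc x \<longleftrightarrow> Poly_Mapping.lookup a i + N - 1 < Suc x * N"
      by (rule div_less_iff_less_mult[OF assms])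
    also have "\<dots> \<longleftrightarrow> Poly_Mapping.lookup a i \<le> N * x"
      using assms by (auto simp: algebra_simps)
    finally show ?thesis by (simp add: a' less_Suc_eq_le)
  qed
  have "Poly_Mapping.lookup a i = N * Poly_Mapping.lookup a' i" if "i \<notin> Z" for i
  proof -
    have *: "Poly_Mapping.lookup a i = N * Poly_Mapping.lookup s i"
      using s that by (simp add: exponent_cone_iff)
    have "(N * Poly_Mapping.lookup s i + N - 1) div N = Poly_Mapping.lookup s i"
      using assms by (intro div_nat_eqI) (auto simp: algebra_simps)
    then show ?thesis by (simp add: a' *)
  qed
  then have "scale_exponent N -` exponent_cone (a, Z) = exponent_cone (a', Z)"
    using assms by (auto simp: exponent_cone_iff ge)
  then show ?thesis by blast
qed simp

lemma cone_partition_vimage: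
  fixes B :: "('n::finite \<Rightarrow>\<^sub>0 nat) set"
  assumes "cone_partition B E" "N > 0"
  shows "\<exists>E'. cone_partition (scale_exponent N -` B) E' \<and> length E' \<le> length E"
proof -
  have "\<forall>x :: ('n \<Rightarrow>\<^sub>0 nat) \<times> 'n set.
      \<exists>y. scale_exponent N -` exponent_cone x \<in> {{}, exponent_cone y}"
    using scale_exponent_vimage_cone[OF assms(2)] by (metis surj_pair)
  then obtain g where g: "\<And>x :: ('n \<Rightarrow>\<^sub>0 nat) \<times> 'n set.
      scale_exponent N -` exponent_cone x \<in> {{}, exponent_cone (g x)}"
    by metis
  \<comment> \<open>Parts with empty preimage have to be dropped: \<open>exponent_cone\<close> is
    never empty, and \<open>g\<close> says nothing about them.\<close>
  define P where "P = (\<lambda>x :: ('n \<Rightarrow>\<^sub>0 nat) \<times> 'n set. scale_exponent N -` exponent_cone x \<noteq> {})"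
  have P: "exponent_cone (g x) = scale_exponent N -` exponent_cone x" if "P x" for x
    using g[of x] that by (auto simp: P_def)
  have "cone_partition (scale_exponent N -` B) (map g (filter P E))"
    unfolding cone_partition_def
  proof
    have "\<Union> (exponent_cone ` set (map g (filter P E))) =
        (\<Union>x\<in>{x \<in> set E. P x}. scale_exponent N -` exponent_cone x)"
      using P by auto
    also have "\<dots> = (\<Union>x\<in>set E. scale_exponent N -` exponent_cone x)"
      by (auto simp: P_def)
    also have "\<dots> = scale_exponent N -` B"
      using assms(1) by (auto simp: cone_partition_def)
    finally show "\<Union> (exponent_cone ` set (map g (filter P E))) = scale_exponent N -` B" .
    have "sorted_wrt (\<lambda>x y. exponent_cone x \<inter> exponent_cone y = {}) (filter P E)"
      using assms(1) by (simp add: cone_partition_def sorted_wrt_filter)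
    then show "sorted_wrt (\<lambda>x y. exponent_cone x \<inter> exponent_cone y = {}) (map g (filter P E))"
      unfolding sorted_wrt_map
      by (rule sorted_wrt_mono_rel[rotated]) (use P in auto)
  qed
  then show ?thesis by (intro exI conjI) (auto intro: length_filter_le)
qed

section \<open>Monomial bases of quotients of monomial ideals\<close>

text \<open>The exponents of the monomials that form a \<open>K\<close>-basis of \<open>J/I\<close>.\<close>

definition quotient_exponents ::
    "('n::finite, 'k::field) mpoly set \<Rightarrow> ('n, 'k) mpoly set \<Rightarrow> ('n \<Rightarrow>\<^sub>0 nat) set" where
  "quotient_exponents J I = {t. Poly_Mapping.single t 1 \<in> J - I}"

lemma single_in_monomial_ideal_iff:
  assumes "monomial_ideal L" "c \<noteq> 0"
  shows "Poly_Mapping.single t c \<in> L \<longleftrightarrow> Poly_Mapping.single t 1 \<in> L"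
  using assms(2) by (subst monomial_ideal_iff[OF assms(1)]) simp

context
  fixes I J :: "('n::finite, 'k::field) mpoly set"
  assumes monI: "monomial_ideal I" and monJ: "monomial_ideal J"
begin

private lemmas I = monomial_ideal_imp_ideal[OF monI] and J = monomial_ideal_imp_ideal[OF monJ]

private lemmas J' = ideal_poly_ringD[OF J]

private lemmas in_I_iff = monomial_ideal_iff[OF monI] and in_J_iff = monomial_ideal_iff[OF monJ]

interpretation Q: Module.module poly_ring "quotient_module J I"
  by (rule module_quotient_module[OF I J])

lemma smult_coset:
  "p \<odot>\<^bsub>quotient_module J I\<^esub> (I +>\<^bsub>poly_ring\<^esub> f) = I +>\<^bsub>poly_ring\<^esub> (p * f)"
  by (simp add: quotient_module_def coset_smult[OF I])

lemma stanley_space_coset: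
  "stanley_space (quotient_module J I) (I +>\<^bsub>poly_ring\<^esub> f) Z =
     (\<lambda>p. I +>\<^bsub>poly_ring\<^esub> (p * f)) ` polys_in Z"
  by (simp add: stanley_space_def smult_coset)

lemma zero_quotient_module: "\<zero>\<^bsub>quotient_module J I\<^esub> = I +>\<^bsub>poly_ring\<^esub> 0"
  unfolding coset_zero by (simp add: quotient_module_def)

text \<open>The multidegree of a monomial determines its exponent, so a homogeneous representative
  has at most one term.\<close>

lemma homogeneous_nonzero_coset:
  assumes "homogeneous_elem (quotient_module J I) m" "m \<noteq> \<zero>\<^bsub>quotient_module J I\<^esub>"
  obtains a c where "c \<noteq> 0" "Poly_Mapping.single a c \<in> J" "m = I +>\<^bsub>poly_ring\<^esub> Poly_Mapping.single a c"
proof -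
  obtain g f where f: "f \<in> J" "f \<in> homogeneous_polys g" "m = I +>\<^bsub>poly_ring\<^esub> f"
    using assms(1) by (auto simp: homogeneous_elem_def quotient_module_def)
  have "f \<noteq> 0" using assms(2) f(3) by (auto simp: zero_quotient_module)
  then obtain a where a: "Poly_Mapping.lookup f a \<noteq> 0"
    by (metis lookup_zero poly_mapping_eqI)
  have "t = a" if "Poly_Mapping.lookup f t \<noteq> 0" for t
  proof (rule poly_mapping_eqI)
    fix i
    have "(\<lambda>i. int (Poly_Mapping.lookup t i)) = g" "(\<lambda>i. int (Poly_Mapping.lookup a i)) = g"
      using f(2) a that by (auto simp: homogeneous_polys_iff)
    then show "Poly_Mapping.lookup t i = Poly_Mapping.lookup a i" by (metis of_nat_eq_iff)
  qed
  then have "Poly_Mapping.single a (Poly_Mapping.lookup f a) = f"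
    by (intro poly_mapping_eqI) (auto simp: lookup_single when_def)
  with a f(1,3) show ?thesis by (intro that[of "Poly_Mapping.lookup f a" a]) simp_all
qed

section \<open>From Stanley decompositions to partitions into cones\<close>

text \<open>Each clause of a Stanley decomposition yields one property of the cones: freeness keeps
  them away from the exponents of \<open>I\<close>, existence of representations makes them cover,
  and uniqueness makes them disjoint.\<close>

lemma cone_partition_of_stanley_decomposition:
  assumes "stanley_decomposition (quotient_module J I) D"
  shows "\<exists>E. cone_partition (quotient_exponents J I) E \<and> length E = length D"
proof -
  let ?M = "quotient_module J I" and ?c = "\<lambda>f. I +>\<^bsub>poly_ring\<^esub> f"
  define Z where "Z = (\<lambda>k. snd (D ! k))"
  let ?S = "\<lambda>k. stanley_space ?M (fst (D ! k)) (Z k)"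
  have "\<forall>x\<in>set D. fst x \<in> carrier ?M \<and> homogeneous_elem ?M (fst x) \<and>
      (\<forall>p \<in> polys_in (snd x). p \<odot>\<^bsub>?M\<^esub> fst x = \<zero>\<^bsub>?M\<^esub> \<longrightarrow> p = 0)"
    using assms by (auto simp: stanley_decomposition_def)
  then have D: "fst (D ! k) \<in> carrier ?M" "homogeneous_elem ?M (fst (D ! k))"
    "\<And>p. p \<in> polys_in (Z k) \<Longrightarrow> p \<odot>\<^bsub>?M\<^esub> fst (D ! k) = \<zero>\<^bsub>?M\<^esub> \<Longrightarrow> p = 0"
    if "k < length D" for k
    unfolding Z_def using that by (meson nth_mem)+
  have "\<forall>x\<in>carrier ?M. \<exists>!u. u \<in> (\<Pi>\<^sub>E k\<in>{..<length D}. ?S k) \<and> x = finsum ?M u {..<length D}"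
    using assms unfolding stanley_decomposition_def Z_def by (rule conjunct2)
  note rep = bspec[OF this]
  have "\<exists>a c. c \<noteq> 0 \<and> Poly_Mapping.single a c \<in> J \<and> fst (D ! k) = ?c (Poly_Mapping.single a c)"
    if k: "k < length D" for k
  proof -
    \<comment> \<open>Freeness applied to the polynomial 1 shows that the generator is
      nonzero.\<close>
    have "1 \<odot>\<^bsub>?M\<^esub> fst (D ! k) = fst (D ! k)" using Q.smult_one[OF D(1)[OF k]] by simp
    moreover have "(1 :: ('n, 'k) mpoly) \<in> polys_in (Z k)" by (simp add: polys_in_def)
    ultimately have "fst (D ! k) \<noteq> \<zero>\<^bsub>?M\<^esub>" using D(3)[OF k, of 1] by auto
    then show ?thesis using homogeneous_nonzero_coset[OF D(2)[OF k]] by metis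
  qed
  then obtain a c where ac: "\<And>k. k < length D \<Longrightarrow> c k \<noteq> 0"
    "\<And>k. k < length D \<Longrightarrow> Poly_Mapping.single (a k) (c k) \<in> J"
    "\<And>k. k < length D \<Longrightarrow> fst (D ! k) = ?c (Poly_Mapping.single (a k) (c k))"
    by metis
  let ?m = "\<lambda>k. Poly_Mapping.single (a k) (c k)"
  have S: "?S k = (\<lambda>p. ?c (p * ?m k)) ` polys_in (Z k)" if "k < length D" for k
    using ac(3)[OF that] by (simp add: stanley_space_coset)
  define E where "E = map (\<lambda>k. (a k, Z k)) [0..<length D]"
  have sub: "exponent_cone (a k, Z k) \<subseteq> quotient_exponents J I" if k: "k < length D" for k
  proof
    fix t assume "t \<in> exponent_cone (a k, Z k)"
    then obtain s where s: "t = a k + s" "Poly_Mapping.keys s \<subseteq> Z k"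
      by (auto simp: exponent_cone_def)
    let ?p = "Poly_Mapping.single s 1 :: ('n, 'k) mpoly"
    have pm: "?p * ?m k = Poly_Mapping.single t (c k)" by (simp add: mult_single s(1) add.commute)
    have "?p \<noteq> 0" by (metis in_keys_iff keys_single keys_zero one_neq_zero singletonI empty_iff)
    then have "?p \<odot>\<^bsub>?M\<^esub> fst (D ! k) \<noteq> \<zero>\<^bsub>?M\<^esub>"
      using D(3)[OF k, of ?p] s(2) by (auto simp: polys_in_def)
    then have "Poly_Mapping.single t (c k) \<notin> I"
      by (simp add: ac(3)[OF k] smult_coset zero_quotient_module coset_eq_iff[OF I] pm)
    moreover have "Poly_Mapping.single t (c k) \<in> J"
      using J'(3)[OF ac(2)[OF k], of ?p] by (simp add: pm)
    ultimately show "t \<in> quotient_exponents J I"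
      unfolding quotient_exponents_def
      by (simp add: monI monJ ac(1)[OF k] single_in_monomial_ideal_iff[of _ "c k"])
  qed
  \<comment> \<open>Outside all cones \<open>x^t\<close> has coefficient 0 in every sum of elements
    of the summands. Subtracting such a sum from \<open>x^t\<close> leaves coefficient 1, so an
    element of \<open>I\<close> would contain \<open>x^t\<close>, and \<open>I\<close> is
    monomial.\<close>
  have cover: "\<exists>k<length D. t \<in> exponent_cone (a k, Z k)" if t: "t \<in> quotient_exponents J I" for t
  proof (rule ccontr)
    assume no: "\<not> (\<exists>k<length D. t \<in> exponent_cone (a k, Z k))"
    let ?t = "Poly_Mapping.single t 1 :: ('n, 'k) mpoly"
    have "?c ?t \<in> carrier ?M" using t by (auto simp: quotient_exponents_def quotient_module_def)
    then obtain u where u: "u \<in> (\<Pi>\<^sub>E k\<in>{..<length D}. ?S k)" "?c ?t = finsum ?M u {..<length D}"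
      using ex1_implies_ex[OF rep] by blast
    have "\<forall>k\<in>{..<length D}. \<exists>p. p \<in> polys_in (Z k) \<and> u k = ?c (p * ?m k)"
      using u(1) S by (auto simp: PiE_iff)
    then obtain p where p: "\<And>k. k < length D \<Longrightarrow> p k \<in> polys_in (Z k)"
      "\<And>k. k < length D \<Longrightarrow> u k = ?c (p k * ?m k)" by (metis lessThan_iff)
    have "p k * ?m k \<in> J" if "k \<in> {..<length D}" for k using J'(3) ac(2) that by simp
    then have "finsum ?M (\<lambda>k. ?c (p k * ?m k)) {..<length D} = ?c (\<Sum>k<length D. p k * ?m k)"
      by (intro finsum_quotient_module[OF I J]) auto
    moreover have "finsum ?M u {..<length D} = finsum ?M (\<lambda>k. ?c (p k * ?m k)) {..<length D}"
      using p(2) J'(3) ac(2) by (intro Q.M.finsum_cong') (auto simp: quotient_module_def)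
    ultimately have d: "?t - (\<Sum>k<length D. p k * ?m k) \<in> I"
      using u(2) by (simp add: coset_eq_iff[OF I])
    have "Poly_Mapping.lookup (p k * ?m k) t = 0" if k: "k < length D" for k
    proof (rule ccontr)
      assume "Poly_Mapping.lookup (p k * ?m k) t \<noteq> 0"
      then have "t \<in> Poly_Mapping.keys (?m k * p k)" by (simp add: in_keys_iff mult.commute)
      then obtain s where "t = a k + s" "s \<in> Poly_Mapping.keys (p k)"
        by (rule in_keys_single_times)
      with p(1)[OF k] have "t \<in> exponent_cone (a k, Z k)"
        by (auto simp: exponent_cone_def polys_in_def)
      with no k show False by blast
    qed
    then have "Poly_Mapping.lookup (?t - (\<Sum>k<length D. p k * ?m k)) t = 1"
      by (simp add: lookup_minus lookup_sum)
    then have "?t \<in> I" by (intro bspec[OF iffD1[OF in_I_iff d]]) (simp add: in_keys_iff)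
    with t show False by (simp add: quotient_exponents_def)
  qed
  have disj: "exponent_cone (a i, Z i) \<inter> exponent_cone (a j, Z j) = {}"
    if ij: "i < length D" "j < length D" "i \<noteq> j" for i j
  proof (rule ccontr)
    assume "exponent_cone (a i, Z i) \<inter> exponent_cone (a j, Z j) \<noteq> {}"
    then obtain t where t: "t \<in> exponent_cone (a i, Z i)" "t \<in> exponent_cone (a j, Z j)" by blast
    then have tB: "t \<in> quotient_exponents J I" using sub ij by blast
    let ?t = "Poly_Mapping.single t 1 :: ('n, 'k) mpoly"
    \<comment> \<open>The class of \<open>x^t\<close> at position \<open>l\<close> and zero
      elsewhere. For a common exponent of the cones \<open>i\<close> and \<open>j\<close>, both
      \<open>?u i\<close> and \<open>?u j\<close> represent this class, and they differ at position
      \<open>i\<close>.\<close>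
    let ?u = "\<lambda>l. \<lambda>k\<in>{..<length D}. ?c (if k = l then ?t else 0)"
    have "?u l \<in> (\<Pi>\<^sub>E k\<in>{..<length D}. ?S k) \<and> ?c ?t = finsum ?M (?u l) {..<length D}"
      if l: "l < length D" "t \<in> exponent_cone (a l, Z l)" for l
    proof
      obtain s where s: "t = a l + s" "Poly_Mapping.keys s \<subseteq> Z l"
        using l(2) by (auto simp: exponent_cone_def)
      \<comment> \<open>The factor \<open>1 / c l\<close> cancels the scalar of the
        generator.\<close>
      have "?t = Poly_Mapping.single s (1 / c l) * ?m l"
        using ac(1)[OF l(1)] by (simp add: mult_single s(1) add.commute)
      moreover have "Poly_Mapping.single s (1 / c l) \<in> polys_in (Z l)"
        using s(2) by (simp add: polys_in_def)
      ultimately have "?c ?t \<in> ?S l" unfolding S[OF l(1)] by (metis image_eqI)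
      moreover have "?c 0 \<in> ?S k" if "k < length D" for k
        unfolding S[OF that] by (rule image_eqI[of _ _ 0]) (simp_all add: polys_in_def)
      ultimately show "?u l \<in> (\<Pi>\<^sub>E k\<in>{..<length D}. ?S k)" by auto
      have J0: "(if k = l then ?t else 0) \<in> J" for k
        using tB J'(1) by (simp add: quotient_exponents_def)
      have "finsum ?M (?u l) {..<length D} = finsum ?M (\<lambda>k. ?c (if k = l then ?t else 0)) {..<length D}"
        using J0 by (intro Q.M.finsum_cong') (auto simp: quotient_module_def)
      also have "\<dots> = ?c (\<Sum>k<length D. if k = l then ?t else 0)"
        using J0 by (intro finsum_quotient_module[OF I J]) auto
      also have "(\<Sum>k<length D. if k = l then ?t else 0) = ?t" using l(1) by simp
      finally show "?c ?t = finsum ?M (?u l) {..<length D}" by (rule sym)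
    qed
    note u = this[OF ij(1) t(1)] this[OF ij(2) t(2)]
    have "?c ?t \<in> carrier ?M"
      using tB by (auto simp: quotient_exponents_def quotient_module_def)
    note unique = rep[OF this]
    have "?u i = ?u j"
      using the1_equality[OF unique, OF u(1)] the1_equality[OF unique, OF u(2)] by argo
    then have "?c ?t = ?c 0" using ij by (auto dest!: fun_cong[of _ _ i])
    then show False using tB by (simp add: coset_eq_iff[OF I] quotient_exponents_def)
  qed
  have "cone_partition (quotient_exponents J I) E"
    unfolding cone_partition_def
  proof
    show "\<Union> (exponent_cone ` set E) = quotient_exponents J I"
      using sub cover by (fastforce simp: E_def)
    show "sorted_wrt (\<lambda>x y. exponent_cone x \<inter> exponent_cone y = {}) E"
      unfolding sorted_wrt_iff_nth_less using disj by (auto simp: E_def)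
  qed
  then show ?thesis by (intro exI[of _ E]) (simp add: E_def)
qed

section \<open>From partitions into cones to Stanley decompositions\<close>

text \<open>The generators are the monomials at the apexes. Disjointness allows the coefficients of
  each \<open>p k\<close> to be read off from the sum of all \<open>p j * x^(a j)\<close>, which
  gives freeness and uniqueness; covering gives existence.\<close>

lemma stanley_decomposition_of_cone_partition:
  assumes "cone_partition (quotient_exponents J I) E"
  shows "\<exists>D. stanley_decomposition (quotient_module J I) D \<and> length D = length E"
proof -
  let ?M = "quotient_module J I" and ?c = "\<lambda>f. I +>\<^bsub>poly_ring\<^esub> f"
  define a Z where "a = (\<lambda>k. fst (E ! k))" and "Z = (\<lambda>k. snd (E ! k))"
  have Ek: "E ! k = (a k, Z k)" for k by (simp add: a_def Z_def)
  let ?m = "\<lambda>k. Poly_Mapping.single (a k) 1 :: ('n, 'k) mpoly"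
  have sub: "exponent_cone (a k, Z k) \<subseteq> quotient_exponents J I" if "k < length E" for k
    using assms nth_mem[OF that] by (auto simp: cone_partition_def Ek)
  have cover: "\<exists>k<length E. t \<in> exponent_cone (a k, Z k)" if "t \<in> quotient_exponents J I" for t
  proof -
    have "t \<in> \<Union> (exponent_cone ` set E)" using assms that by (simp add: cone_partition_def)
    then obtain x where "x \<in> set E" "t \<in> exponent_cone x" by blast
    then show ?thesis by (metis Ek in_set_conv_nth)
  qed
  have disj: "i = j" if "i < length E" "j < length E"
    "t \<in> exponent_cone (a i, Z i)" "t \<in> exponent_cone (a j, Z j)" for i j t
    using assms that unfolding cone_partition_def sorted_wrt_iff_nth_less
    by (metis Ek disjoint_iff linorder_neqE_nat)
  have am: "?m k \<in> J" if "k < length E" for k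
  proof -
    have "a k \<in> exponent_cone (a k, Z k)" by (simp add: exponent_cone_iff)
    then show ?thesis using sub[OF that] by (auto simp: quotient_exponents_def)
  qed
  \<comment> \<open>Only the summand \<open>k\<close> can contribute at \<open>a k + s\<close>,
    since a contribution of another summand would put this exponent into two cones.\<close>
  have coeff: "Poly_Mapping.lookup (\<Sum>j<length E. p j * ?m j) (a k + s) = Poly_Mapping.lookup (p k) s"
    if k: "k < length E" "Poly_Mapping.keys s \<subseteq> Z k"
      and p: "\<And>j. j < length E \<Longrightarrow> p j \<in> polys_in (Z j)" for p k s
  proof -
    have "Poly_Mapping.lookup (p j * ?m j) (a k + s) = 0" if j: "j < length E" "j \<noteq> k" for j
    proof (rule ccontr)
      assume "Poly_Mapping.lookup (p j * ?m j) (a k + s) \<noteq> 0"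
      then have "a k + s \<in> Poly_Mapping.keys (?m j * p j)" by (simp add: in_keys_iff mult.commute)
      then obtain r where "a k + s = a j + r" "r \<in> Poly_Mapping.keys (p j)"
        by (rule in_keys_single_times)
      with p[OF j(1)] have "a k + s \<in> exponent_cone (a j, Z j)"
        by (auto simp: exponent_cone_def polys_in_def)
      moreover have "a k + s \<in> exponent_cone (a k, Z k)"
        using k(2) by (auto simp: exponent_cone_def)
      ultimately show False using disj j k(1) by blast
    qed
    then have "(\<Sum>j<length E. Poly_Mapping.lookup (p j * ?m j) (a k + s)) =
        (\<Sum>j<length E. if j = k then Poly_Mapping.lookup (p k * ?m k) (a k + s) else 0)"
      by (intro sum.cong) auto
    also have "\<dots> = Poly_Mapping.lookup (?m k * p k) (a k + s)" using k(1) by (simp add: mult.commute)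
    finally show ?thesis by (simp add: lookup_sum lookup_single_times)
  qed
  \<comment> \<open>Elements of \<open>I\<close> have no terms with exponents in the cones. This
    serves freeness, with a family concentrated at \<open>k\<close>, and uniqueness, with the
    difference of two families.\<close>
  have zeroI: "p = 0" if k: "k < length E" and q: "\<And>j. j < length E \<Longrightarrow> q j \<in> polys_in (Z j)"
    "p = q k" "(\<Sum>j<length E. q j * ?m j) \<in> I" for p q k
  proof (rule poly_mapping_eqI)
    fix s
    show "Poly_Mapping.lookup p s = Poly_Mapping.lookup 0 s"
    proof (cases "Poly_Mapping.keys s \<subseteq> Z k")
      case True
      then have "a k + s \<in> exponent_cone (a k, Z k)" by (auto simp: exponent_cone_def)
      then have "(Poly_Mapping.single (a k + s) 1 :: ('n, 'k) mpoly) \<notin> I"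
        using sub[OF k] by (auto simp: quotient_exponents_def)
      then have "a k + s \<notin> Poly_Mapping.keys (\<Sum>j<length E. q j * ?m j)"
        using bspec[OF iffD1[OF in_I_iff q(3)]] by blast
      then show ?thesis using coeff[of k s q] k True q(1,2) by (simp add: in_keys_iff)
    next
      case False
      then show ?thesis using q(1)[OF k] q(2) by (auto simp: polys_in_def in_keys_iff)
    qed
  qed
  define D where "D = map (\<lambda>k. (?c (?m k), Z k)) [0..<length E]"
  have len: "length D = length E" by (simp add: D_def)
  let ?S = "\<lambda>k. (\<lambda>p. ?c (p * ?m k)) ` polys_in (Z k)"
  have S: "stanley_space ?M (fst (D ! k)) (snd (D ! k)) = ?S k" if "k < length E" for k
    using that by (simp add: D_def stanley_space_coset)
  have fin: "finsum ?M u {..<length E} = ?c (\<Sum>k<length E. p k * ?m k)"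
    if "\<And>k. k < length E \<Longrightarrow> u k = ?c (p k * ?m k)" for u p
  proof -
    have "finsum ?M u {..<length E} = finsum ?M (\<lambda>k. ?c (p k * ?m k)) {..<length E}"
      using that J'(3) am by (intro Q.M.finsum_cong') (auto simp: quotient_module_def)
    also have "\<dots> = ?c (\<Sum>k<length E. p k * ?m k)"
      using J'(3) am by (intro finsum_quotient_module[OF I J]) auto
    finally show ?thesis .
  qed
  have gen: "?c (?m k) \<in> carrier ?M \<and> homogeneous_elem ?M (?c (?m k)) \<and>
      (\<forall>p \<in> polys_in (Z k). p \<odot>\<^bsub>?M\<^esub> ?c (?m k) = \<zero>\<^bsub>?M\<^esub> \<longrightarrow> p = 0)" if k: "k < length E" for k
  proof (intro conjI ballI impI)
    show "?c (?m k) \<in> carrier ?M" using am[OF k] by (auto simp: quotient_module_def)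
    have "?m k \<in> homogeneous_polys (\<lambda>i. int (Poly_Mapping.lookup (a k) i))"
      by (simp add: homogeneous_polys_def)
    then show "homogeneous_elem ?M (?c (?m k))"
      using am[OF k] by (auto simp: homogeneous_elem_def quotient_module_def)
  next
    fix p assume p: "p \<in> polys_in (Z k)" "p \<odot>\<^bsub>?M\<^esub> ?c (?m k) = \<zero>\<^bsub>?M\<^esub>"
    have "(\<Sum>j<length E. (if j = k then p else 0) * ?m j) = p * ?m k"
      using k by (simp add: if_distrib[of "\<lambda>x. x * _"] cong: if_cong)
    moreover have "p * ?m k \<in> I"
      using p(2) by (simp add: smult_coset zero_quotient_module coset_eq_iff[OF I])
    ultimately show "p = 0"
      using p(1) by (intro zeroI[OF k, of "\<lambda>j. if j = k then p else 0"]) (auto simp: polys_in_def)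
  qed
  have "\<exists>!u. u \<in> (\<Pi>\<^sub>E k\<in>{..<length E}. ?S k) \<and> x = finsum ?M u {..<length E}"
    if x: "x \<in> carrier ?M" for x
  proof -
    obtain f where f: "f \<in> J" "x = ?c f" using x by (auto simp: quotient_module_def)
    define K where "K = (\<lambda>k. {s. Poly_Mapping.keys s \<subseteq> Z k \<and> a k + s \<in> Poly_Mapping.keys f})"
    have finK: "finite (K k)" for k
      by (rule inj_on_finite[of "\<lambda>s. a k + s" _ "Poly_Mapping.keys f"]) (auto simp: K_def)
    \<comment> \<open>The terms of \<open>f\<close> lying in cone \<open>k\<close>, divided by
      \<open>x^(a k)\<close>.\<close>
    define p where "p = (\<lambda>k. \<Sum>s\<in>K k. Poly_Mapping.single s (Poly_Mapping.lookup f (a k + s)))"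
    have lp: "Poly_Mapping.lookup (p k) s =
        (if Poly_Mapping.keys s \<subseteq> Z k then Poly_Mapping.lookup f (a k + s) else 0)" for k s
      using finK[of k]
      by (auto simp: p_def lookup_sum lookup_single when_def sum.delta' K_def in_keys_iff)
    have pZ: "p k \<in> polys_in (Z k)" for k
      unfolding polys_in_def
    proof (rule CollectI, rule ballI, rule ccontr)
      fix s assume "s \<in> Poly_Mapping.keys (p k)" and s: "\<not> Poly_Mapping.keys s \<subseteq> Z k"
      then have "Poly_Mapping.lookup (p k) s \<noteq> 0" by (simp only: in_keys_iff not_False_eq_True)
      moreover have "Poly_Mapping.lookup (p k) s = 0" unfolding lp by (rule if_not_P[OF s])
      ultimately show False by contradiction
    qed
    \<comment> \<open>The difference lies in \<open>J\<close>, so a term of it outside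
      \<open>I\<close> has its exponent in some cone; there the coefficients of \<open>f\<close> and
      of the sum agree and cancel.\<close>
    have "f - (\<Sum>k<length E. p k * ?m k) \<in> I"
    proof (subst in_I_iff, rule ballI, rule ccontr)
      fix t assume t: "t \<in> Poly_Mapping.keys (f - (\<Sum>k<length E. p k * ?m k))"
        and tI: "(Poly_Mapping.single t 1 :: ('n, 'k) mpoly) \<notin> I"
      have "(\<Sum>k<length E. p k * ?m k) \<in> J"
        using J'(3) am by (intro ideal_poly_ring_sum[OF J]) auto
      then have "f - (\<Sum>k<length E. p k * ?m k) \<in> J" using f(1) by (intro J'(5))
      then have "t \<in> quotient_exponents J I"
        using bspec[OF iffD1[OF in_J_iff] t] tI by (simp add: quotient_exponents_def)
      then obtain k s where ks: "k < length E" "t = a k + s" "Poly_Mapping.keys s \<subseteq> Z k"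
        using cover by (fastforce simp: exponent_cone_def)
      then have "Poly_Mapping.lookup (\<Sum>k<length E. p k * ?m k) t = Poly_Mapping.lookup f t"
        using coeff[of k s p] pZ by (simp add: lp)
      then show False using t by (simp add: in_keys_iff lookup_minus)
    qed
    then have fp: "?c f = ?c (\<Sum>k<length E. p k * ?m k)" by (simp add: coset_eq_iff[OF I])
    show ?thesis
    proof (rule ex1I[of _ "\<lambda>k\<in>{..<length E}. ?c (p k * ?m k)"], intro conjI)
      show "(\<lambda>k\<in>{..<length E}. ?c (p k * ?m k)) \<in> (\<Pi>\<^sub>E k\<in>{..<length E}. ?S k)"
        using pZ by auto
      show "x = finsum ?M (\<lambda>k\<in>{..<length E}. ?c (p k * ?m k)) {..<length E}"
        by (subst fin[of _ p]) (auto simp: f(2) fp)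
    next
      fix u assume u: "u \<in> (\<Pi>\<^sub>E k\<in>{..<length E}. ?S k) \<and> x = finsum ?M u {..<length E}"
      then have "\<forall>k\<in>{..<length E}. \<exists>q. q \<in> polys_in (Z k) \<and> u k = ?c (q * ?m k)"
        by (auto simp: PiE_iff)
      then obtain q where q: "\<And>k. k < length E \<Longrightarrow> q k \<in> polys_in (Z k)"
        "\<And>k. k < length E \<Longrightarrow> u k = ?c (q k * ?m k)" by (metis lessThan_iff)
      have "?c (\<Sum>k<length E. q k * ?m k) = ?c (\<Sum>k<length E. p k * ?m k)"
        using u fin[OF q(2)] f(2) fp by simp
      then have "(\<Sum>k<length E. (q k - p k) * ?m k) \<in> I"
        by (simp add: coset_eq_iff[OF I] left_diff_distrib sum_subtractf)
      moreover have "q k - p k \<in> polys_in (Z k)" if "k < length E" for k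
        using q(1)[OF that] pZ by (rule polys_in_diff)
      ultimately have "q k - p k = 0" if "k < length E" for k
        using zeroI[OF that, of "\<lambda>k. q k - p k"] by blast
      then have "u k = ?c (p k * ?m k)" if "k < length E" for k
        using q(2) that by simp
      then show "u = (\<lambda>k\<in>{..<length E}. ?c (p k * ?m k))"
        using u by (intro extensionalityI[of _ "{..<length E}"]) (auto simp: PiE_def)
    qed
  qed
  moreover have "(\<Pi>\<^sub>E k\<in>{..<length D}. stanley_space ?M (fst (D ! k)) (snd (D ! k))) =
      (\<Pi>\<^sub>E k\<in>{..<length E}. ?S k)"
    unfolding len by (intro PiE_cong) (simp add: S)
  ultimately have "stanley_decomposition ?M D"
    unfolding stanley_decomposition_def using gen by (auto simp: len D_def)
  then show ?thesis using len by blast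
qed

end

section \<open>Comparison with the radicals and the inequality\<close>

text \<open>Since a difference \<open>J - I\<close> is involved, membership must be translated in
  both directions by the same \<open>N\<close>. One direction is the uniform exponent; the other is
  the definition of the radical, as \<open>x^(N t)\<close> is the \<open>N\<close>-th power of
  \<open>x^t\<close>.\<close>

lemma quotient_exponents_radical:
  fixes I J :: "('n::finite, 'k::field) mpoly set"
  assumes "ideal I poly_ring" "ideal J poly_ring"
  shows "\<exists>N>0. quotient_exponents (ideal_radical J) (ideal_radical I) =
    scale_exponent N -` quotient_exponents J I"
proof -
  have power: "Poly_Mapping.single t 1 \<in> ideal_radical L"
    if "N > 0" "Poly_Mapping.single (scale_exponent N t) 1 \<in> L" for N t and L :: "('n, 'k) mpoly set"
    using that by (auto simp: ideal_radical_def monomial_power)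
  obtain N1 N2 where N: "\<And>N t. N \<ge> N1 \<Longrightarrow> Poly_Mapping.single t 1 \<in> ideal_radical I \<Longrightarrow>
      Poly_Mapping.single (scale_exponent N t) 1 \<in> I"
    "\<And>N t. N \<ge> N2 \<Longrightarrow> Poly_Mapping.single t 1 \<in> ideal_radical J \<Longrightarrow>
      Poly_Mapping.single (scale_exponent N t) 1 \<in> J"
    using ideal_radical_uniform_exponent[OF assms(1)] ideal_radical_uniform_exponent[OF assms(2)]
    by metis
  show ?thesis
    \<comment> \<open>\<open>Suc\<close> makes the exponent positive even if both bounds are
      0.\<close>
    using N[of "Suc (max N1 N2)"] power[of "Suc (max N1 N2)"]
    by (intro exI[of _ "Suc (max N1 N2)"]) (auto simp: quotient_exponents_def)
qed

theorem theorem2p15: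
  fixes I J :: "('n::finite, 'k::field) mpoly set"
  assumes "monomial_ideal I" and "monomial_ideal J" and "I \<subset> J"
  shows "slength (quotient_module J I)
           \<ge> slength (quotient_module (ideal_radical J) (ideal_radical I))"
  unfolding slength_def[of "quotient_module J I"]
\<comment> \<open>Each decomposition of \<open>J/I\<close> is treated on its own, so the existence
  of a shortest one need not be discussed.\<close>
proof (rule INF_greatest, clarify)
  fix D assume "stanley_decomposition (quotient_module J I) D"
  then obtain E where E: "cone_partition (quotient_exponents J I) E" "length E = length D"
    using cone_partition_of_stanley_decomposition[OF assms(1,2)] by blast
  obtain N where N: "N > 0" "quotient_exponents (ideal_radical J) (ideal_radical I) =
      scale_exponent N -` quotient_exponents J I"
    using quotient_exponents_radical assms(1,2)[THEN monomial_ideal_imp_ideal] by blast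
  obtain E' where E': "cone_partition (quotient_exponents (ideal_radical J) (ideal_radical I)) E'"
    "length E' \<le> length D"
    using cone_partition_vimage[OF E(1) N(1)] E(2) N(2) by metis
  then obtain D' where
    "stanley_decomposition (quotient_module (ideal_radical J) (ideal_radical I)) D'"
    "length D' \<le> length D"
    using stanley_decomposition_of_cone_partition[OF assms(1,2)[THEN monomial_ideal_ideal_radical]]
    by metis
  then show "slength (quotient_module (ideal_radical J) (ideal_radical I)) \<le> enat (length D)"
    unfolding slength_def by (intro INF_lower2[of D']) auto
qed

end
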